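(* Let $c\in\mathbb{R}^n$, $L\in\mathbb{R}^{n\times n}$, and symmetric $Q^{(1)},\dots,Q^{(n)}\in\mathbb{R}^{n\times n}$ be such that $f(x)=(x^\top Q^{(i)}x)_{i=1}^n$ satisfies $x^\top f(x)=0$ for all $x\in\mathbb{R}^n$. Let $m\in\mathbb{R}^n$ be such that $A_s(m)\prec 0$. Then the optimal value of the (non-convex) quadratically constrained quadratic program $$\max_{y\in\mathbb{R}^n}\; y^\top y \quad\text{subject to}\quad d(m)^\top y + y^\top A_s(m)y\ge 0$$ is equal to the optimal value of its dual semidefinite program $$\min_{\lambda\ge 0,\ \gamma\in\mathbb{R}}\; \gamma\quad\text{subject to}\quad \begin{bmatrix} I_n+\lambda A_s(m) & \frac{\lambda}{2}d(m)\\ \frac{\lambda}{2}d(m)^\top & -\gamma\end{bmatrix}\preceq 0 .$$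
   Context: Here $d(m)=c+Lm+f(m)$ and $A_s(m)=\frac12(L+L^\top)-\sum_{k=1}^n m_kQ^{(k)}$. For symmetric matrices $\prec,\preceq$ denote the Loewner (definiteness) order, and $I_n$ is the identity matrix. *)

theory Defs
  imports "HOL-Analysis.Analysis"
begin

definition symmetric_matrix :: "real^'n^'n \<Rightarrow> bool" where
  "symmetric_matrix A \<longleftrightarrow> transpose A = A"

(* The Loewner order compares symmetric matrices only, so symmetry is part of the relations. *)

definition loewner_le :: "real^'n^'n \<Rightarrow> real^'n^'n \<Rightarrow> bool"  (infix "\<preceq>\<^sub>L" 50) where
  "A \<preceq>\<^sub>L B \<longleftrightarrow> symmetric_matrix A \<and> symmetric_matrix B \<and> (\<forall>x. 0 \<le> x \<bullet> ((B - A) *v x))"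

definition loewner_less :: "real^'n^'n \<Rightarrow> real^'n^'n \<Rightarrow> bool"  (infix "\<prec>\<^sub>L" 50) where
  "A \<prec>\<^sub>L B \<longleftrightarrow> symmetric_matrix A \<and> symmetric_matrix B \<and> (\<forall>x. x \<noteq> 0 \<longrightarrow> 0 < x \<bullet> ((B - A) *v x))"

definition quad_map :: "('n \<Rightarrow> real^'n^'n) \<Rightarrow> real^'n \<Rightarrow> real^'n" where
  "quad_map Q x = (\<chi> i. x \<bullet> (Q i *v x))"

definition d_vec :: "real^'n \<Rightarrow> real^'n^'n \<Rightarrow> ('n \<Rightarrow> real^'n^'n) \<Rightarrow> real^'n \<Rightarrow> real^'n" where
  "d_vec c L Q m = c + L *v m + quad_map Q m"

definition A_s :: "real^'n^'n \<Rightarrow> ('n \<Rightarrow> real^'n^'n) \<Rightarrow> real^'n \<Rightarrow> real^'n^'n" where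
  "A_s L Q m = (1/2) *\<^sub>R (L + transpose L) - (\<Sum>k\<in>UNIV. m $ k *\<^sub>R Q k)"

(* The (n+1) x (n+1) block matrix [A, u; v^T, s]. *)
definition bordered_matrix ::
  "real^'n^'n \<Rightarrow> real^'n \<Rightarrow> real^'n \<Rightarrow> real \<Rightarrow> real^('n + unit)^('n + unit)" where
  "bordered_matrix A u v s = (\<chi> i j. case i of
       Inl k \<Rightarrow> (case j of Inl l \<Rightarrow> A $ k $ l | Inr _ \<Rightarrow> u $ k)
     | Inr _ \<Rightarrow> (case j of Inl l \<Rightarrow> v $ l | Inr _ \<Rightarrow> s))"

definition qcqp_feasible :: "real^'n \<Rightarrow> real^'n^'n \<Rightarrow> ('n \<Rightarrow> real^'n^'n) \<Rightarrow> real^'n \<Rightarrow> (real^'n) set" where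
  "qcqp_feasible c L Q m = {y. d_vec c L Q m \<bullet> y + y \<bullet> (A_s L Q m *v y) \<ge> 0}"

definition sdp_feasible :: "real^'n \<Rightarrow> real^'n^'n \<Rightarrow> ('n \<Rightarrow> real^'n^'n) \<Rightarrow> real^'n \<Rightarrow> (real \<times> real) set" where
  "sdp_feasible c L Q m = {(lam, \<gamma>). lam \<ge> 0 \<and>
     bordered_matrix (mat 1 + lam *\<^sub>R A_s L Q m) ((lam / 2) *\<^sub>R d_vec c L Q m)
                     ((lam / 2) *\<^sub>R d_vec c L Q m) (- \<gamma>) \<preceq>\<^sub>L 0}"

(* Optimal values are extended reals, so that infeasible or unbounded programs
   do not get a spurious finite value. *)

definition qcqp_value :: "real^'n \<Rightarrow> real^'n^'n \<Rightarrow> ('n \<Rightarrow> real^'n^'n) \<Rightarrow> real^'n \<Rightarrow> ereal" where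
  "qcqp_value c L Q m = (SUP y\<in>qcqp_feasible c L Q m. ereal (y \<bullet> y))"

definition sdp_value :: "real^'n \<Rightarrow> real^'n^'n \<Rightarrow> ('n \<Rightarrow> real^'n^'n) \<Rightarrow> real^'n \<Rightarrow> ereal" where
  "sdp_value c L Q m = (INF (lam, \<gamma>)\<in>sdp_feasible c L Q m. ereal \<gamma>)"

end

theory Submission
  imports Defs
begin

text \<open>
  Write \<open>A\<close> for \<open>A_s L Q m\<close>, \<open>d\<close> for \<open>d_vec c L Q m\<close> and \<open>g y = d \<bullet> y + y \<bullet> (A *v y)\<close>. The quadratic form
  of the bordered matrix at a vector \<open>(y, t)\<close> is \<open>y \<bullet> y + lam * (t * (d \<bullet> y) + y \<bullet> (A *v y)) - \<gamma> * t\<^sup>2\<close>.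
  At \<open>t = 1\<close> this gives weak duality, so it suffices to find one primal feasible \<open>y0\<close> and one
  multiplier \<open>lam \<ge> 0\<close> such that \<open>(lam, y0 \<bullet> y0)\<close> is dual feasible; this pair then also attains
  both optima.

  As \<open>A\<close> is negative definite, \<open>{y. g y \<ge> 0}\<close> is compact and \<open>y \<bullet> y\<close> has a maximiser \<open>y0\<close> on it.
  If \<open>d = 0\<close>, then \<open>y0 = 0\<close> and any large \<open>lam\<close> works. Otherwise \<open>g y0 = 0\<close> and the gradient
  \<open>p = d + 2 *\<^sub>R (A *v y0)\<close> of \<open>g\<close> at \<open>y0\<close> does not vanish. If \<open>p \<bullet> v > 0\<close>, then the line from \<open>y0\<close> in direction
  \<open>v\<close> runs through the feasible ellipsoid until it leaves it at parameter
  \<open>- (p \<bullet> v) / (v \<bullet> (A *v v))\<close>, and maximality at this exit point yields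
  \<open>2 * (y0 \<bullet> v) * (- (v \<bullet> (A *v v))) + (p \<bullet> v) * (v \<bullet> v) \<le> 0\<close> (\<open>maximizer_chord\<close>).
  This one inequality contains both optimality conditions. It forces \<open>y0 \<bullet> v < 0\<close> whenever
  \<open>p \<bullet> v > 0\<close>, hence \<open>2 *\<^sub>R y0 = - lam *\<^sub>R p\<close> with \<open>lam \<ge> 0\<close> (\<open>opposite_of_halfspace\<close>). Substituting this
  back and dividing by \<open>p \<bullet> v\<close> shows that \<open>I + lam A\<close> is negative semidefinite off the hyperplane
  \<open>p \<bullet> v = 0\<close>, and so everywhere by continuity (\<open>nonpos_quadratic_dense\<close>). Completing the square,
  the bordered form equals the form of \<open>I + lam A\<close> at \<open>y - t *\<^sub>R y0\<close>, which is nonpositive.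
\<close>

section \<open>Quadratic forms of symmetric matrices\<close>

lemma symmetric_matrix_inner:
  fixes A :: "real^'n^'n"
  assumes "symmetric_matrix A"
  shows "x \<bullet> (A *v y) = y \<bullet> (A *v x)"
proof -
  have "x \<bullet> (A *v y) = (transpose A *v x) \<bullet> y"
    by (simp only: transpose_matrix_vector dot_lmul_matrix)
  then show ?thesis
    using assms by (simp only: symmetric_matrix_def inner_commute)
qed

lemma zero_diff_matrix_vector:
  fixes A :: "real^'n^'m"
  shows "(0 - A) *v x = - (A *v x)"
  unfolding matrix_vector_mult_diff_rdistrib by simp

lemma symmetric_quadratic_expand:
  fixes A :: "real^'n^'n"
  assumes "symmetric_matrix A"
  shows "(x + t *\<^sub>R v) \<bullet> (A *v (x + t *\<^sub>R v))
       = x \<bullet> (A *v x) + 2 * t * (v \<bullet> (A *v x)) + t\<^sup>2 * (v \<bullet> (A *v v))"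
proof -
  have "(x + t *\<^sub>R v) \<bullet> (A *v (x + t *\<^sub>R v))
      = x \<bullet> (A *v x) + t * (x \<bullet> (A *v v)) + t * (v \<bullet> (A *v x)) + t * t * (v \<bullet> (A *v v))"
    by (simp add: matrix_vector_right_distrib matrix_vector_mult_scaleR inner_add_left inner_add_right
        distrib_left)
  also have "x \<bullet> (A *v v) = v \<bullet> (A *v x)" by (rule symmetric_matrix_inner[OF assms])
  finally show ?thesis by (simp add: power2_eq_square)
qed

text \<open>The form attains a negative maximum on the unit sphere; homogeneity does the rest.\<close>

lemma negative_definite_coercive:
  fixes A :: "real^'n^'n"
  assumes "\<And>x. x \<noteq> 0 \<Longrightarrow> x \<bullet> (A *v x) < 0"
  obtains \<mu> where "\<mu> > 0" "\<And>x. x \<bullet> (A *v x) \<le> - \<mu> * (x \<bullet> x)"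
proof -
  let ?S = "sphere (0::real^'n) 1"
  have "continuous_on ?S (\<lambda>x. x \<bullet> (A *v x))"
    by (intro continuous_intros linear_continuous_on_compose matrix_vector_mul_linear)
  moreover have "?S \<noteq> {}"
    using vector_choose_size[of 1] by auto
  ultimately obtain s where s: "s \<in> ?S" "\<And>x. x \<in> ?S \<Longrightarrow> x \<bullet> (A *v x) \<le> s \<bullet> (A *v s)"
    using continuous_attains_sup[OF compact_sphere, of 0 1 "\<lambda>x. x \<bullet> (A *v x)"] by blast
  define \<mu> where "\<mu> = - (s \<bullet> (A *v s))"
  have "s \<noteq> 0" using s(1) by auto
  then have "\<mu> > 0"
    using assms[of s] by (simp add: \<mu>_def)
  moreover have "x \<bullet> (A *v x) \<le> - \<mu> * (x \<bullet> x)" for x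
  proof (cases "x = 0")
    case False
    have "(inverse (norm x) *\<^sub>R x) \<bullet> (A *v (inverse (norm x) *\<^sub>R x)) \<le> - \<mu>"
      using s(2)[of "inverse (norm x) *\<^sub>R x"] False by (simp add: \<mu>_def)
    then have "x \<bullet> (A *v x) / (norm x)\<^sup>2 \<le> - \<mu>"
      by (simp add: matrix_vector_mult_scaleR power2_eq_square field_simps)
    then show ?thesis
      using False by (simp add: pos_divide_le_eq flip: power2_norm_eq_inner)
  qed simp
  ultimately show ?thesis by (rule that)
qed

text \<open>The complement of the hyperplane \<open>p \<bullet> v = 0\<close> is dense, as moving along \<open>p\<close> leaves the hyperplane.\<close>

lemma nonpos_quadratic_dense:
  fixes M :: "real^'n^'n"
  assumes "p \<noteq> 0" and off: "\<And>v. p \<bullet> v \<noteq> 0 \<Longrightarrow> v \<bullet> (M *v v) \<le> 0"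
  shows "v \<bullet> (M *v v) \<le> 0"
proof (cases "p \<bullet> v = 0")
  case True
  have "((\<lambda>t. (v + t *\<^sub>R p) \<bullet> (M *v (v + t *\<^sub>R p))) \<longlongrightarrow> (v + 0 *\<^sub>R p) \<bullet> (M *v (v + 0 *\<^sub>R p))) (at_right 0)"
    unfolding matrix_vector_right_distrib matrix_vector_mult_scaleR
    by (intro tendsto_intros)
  moreover have "eventually (\<lambda>t. (v + t *\<^sub>R p) \<bullet> (M *v (v + t *\<^sub>R p)) \<le> 0) (at_right 0)"
    unfolding eventually_at_right_field
    using True \<open>p \<noteq> 0\<close> by (intro exI[of _ 1]) (auto intro!: off simp: inner_add_right)
  ultimately show ?thesis
    using tendsto_upperbound by fastforce
qed (rule off)

section \<open>The maximiser and its multiplier\<close>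

text \<open>The case of Farkas' lemma with one inequality: if the component \<open>z\<close> of \<open>y\<close>
  orthogonal to \<open>p\<close> were nonzero, then \<open>z\<close> plus a small positive multiple of \<open>p\<close> would be
  a test vector \<open>v\<close> that violates the hypothesis.\<close>

lemma opposite_of_halfspace:
  fixes p y :: "'a::real_inner"
  assumes "p \<noteq> 0" and neg: "\<And>v. p \<bullet> v > 0 \<Longrightarrow> y \<bullet> v < 0"
  obtains a where "a < 0" "y = a *\<^sub>R p"
proof -
  define a where "a = (y \<bullet> p) / (p \<bullet> p)"
  define z where "z = y - a *\<^sub>R p"
  have pp: "p \<bullet> p > 0" using \<open>p \<noteq> 0\<close> by simp
  have pz: "p \<bullet> z = 0"
    using pp by (simp add: z_def a_def inner_diff_right inner_commute)
  have yz: "y \<bullet> z = z \<bullet> z"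
    using pz by (simp add: z_def inner_diff_left inner_commute algebra_simps)
  have yp: "y \<bullet> p < 0" using neg pp by blast
  have "z = 0"
  proof (rule ccontr)
    assume "z \<noteq> 0"
    \<comment> \<open>The choice of \<open>e\<close> that makes \<open>y\<close> orthogonal to \<open>e *\<^sub>R p + z\<close>.\<close>
    define e where "e = (z \<bullet> z) / (- (y \<bullet> p))"
    have "e > 0" unfolding e_def using \<open>z \<noteq> 0\<close> yp by (intro divide_pos_pos) simp_all
    then have "y \<bullet> (e *\<^sub>R p + z) < 0"
      using pp pz by (intro neg) (simp add: inner_add_right)
    moreover have "e * (y \<bullet> p) = - (z \<bullet> z)" using yp by (simp add: e_def)
    then have "y \<bullet> (e *\<^sub>R p + z) = 0"
      using yz by (simp add: inner_add_right)
    ultimately show False by simp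
  qed
  then have "y = a *\<^sub>R p" by (simp add: z_def)
  moreover have "a < 0" unfolding a_def using yp pp by (rule divide_neg_pos)
  ultimately show ?thesis using that by blast
qed

lemma quadratic_maximizer_exists:
  fixes A :: "real^'n^'n"
  assumes "\<And>x. x \<noteq> 0 \<Longrightarrow> x \<bullet> (A *v x) < 0"
  obtains y0 where "d \<bullet> y0 + y0 \<bullet> (A *v y0) \<ge> 0"
    "\<And>y. d \<bullet> y + y \<bullet> (A *v y) \<ge> 0 \<Longrightarrow> y \<bullet> y \<le> y0 \<bullet> y0"
proof -
  let ?F = "{y. d \<bullet> y + y \<bullet> (A *v y) \<ge> 0}"
  obtain \<mu> where \<mu>: "\<mu> > 0" "\<And>x. x \<bullet> (A *v x) \<le> - \<mu> * (x \<bullet> x)"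
    using negative_definite_coercive assms by blast
  have "norm y \<le> norm d / \<mu>" if "y \<in> ?F" for y
  proof (cases "y = 0")
    case False
    have "\<mu> * (norm y * norm y) \<le> d \<bullet> y"
      using that \<mu>(2)[of y] by (simp add: flip: power2_norm_eq_inner power2_eq_square)
    also have "\<dots> \<le> norm d * norm y" by (rule norm_cauchy_schwarz)
    finally have "\<mu> * norm y \<le> norm d" using False by (simp add: field_simps)
    then show ?thesis using \<mu>(1) by (simp add: field_simps)
  qed (use \<mu>(1) in simp)
  then have "bounded ?F" unfolding bounded_iff by blast
  moreover have "closed ?F"
    by (intro closed_Collect_le continuous_intros linear_continuous_on_compose matrix_vector_mul_linear)
  ultimately have "compact ?F" by (simp add: compact_eq_bounded_closed)
  moreover have "0 \<in> ?F" by simp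
  moreover have "continuous_on ?F (\<lambda>y. y \<bullet> y)" by (intro continuous_intros)
  ultimately obtain y0 where "y0 \<in> ?F" "\<And>y. y \<in> ?F \<Longrightarrow> y \<bullet> y \<le> y0 \<bullet> y0"
    using continuous_attains_sup[of ?F "\<lambda>y. y \<bullet> y"] by blast
  then show ?thesis using that by simp
qed

text \<open>If the constraint were slack at \<open>y0 \<noteq> 0\<close>, then slightly stretching \<open>y0\<close> would keep it feasible.\<close>

lemma maximizer_active:
  fixes A :: "real^'n^'n"
  assumes feas: "d \<bullet> y0 + y0 \<bullet> (A *v y0) \<ge> 0"
    and max: "\<And>y. d \<bullet> y + y \<bullet> (A *v y) \<ge> 0 \<Longrightarrow> y \<bullet> y \<le> y0 \<bullet> y0"
  shows "d \<bullet> y0 + y0 \<bullet> (A *v y0) = 0"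
proof (rule ccontr)
  assume "\<not> ?thesis"
  then have pos: "d \<bullet> y0 + y0 \<bullet> (A *v y0) > 0" and "y0 \<noteq> 0" using feas by auto
  let ?h = "\<lambda>s::real. d \<bullet> (s *\<^sub>R y0) + (s *\<^sub>R y0) \<bullet> (A *v (s *\<^sub>R y0))"
  have "(?h \<longlongrightarrow> ?h 1) (at_right 1)"
    unfolding matrix_vector_mult_scaleR by (intro tendsto_intros)
  then have "eventually (\<lambda>s. ?h s > 0) (at_right 1)"
    using pos by (intro order_tendstoD) auto
  then obtain b where "b > 1" "\<And>s. 1 < s \<Longrightarrow> s < b \<Longrightarrow> ?h s > 0"
    unfolding eventually_at_right_field by blast
  then obtain s where s: "s > 1" "?h s > 0" using dense by blast
  have "s * s * (y0 \<bullet> y0) \<le> y0 \<bullet> y0" using max[of "s *\<^sub>R y0"] s(2) by simp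
  moreover have "s * s > 1" using s(1) by (simp add: less_1_mult)
  ultimately show False using \<open>y0 \<noteq> 0\<close> by simp
qed

text \<open>The far end of the chord of the ellipsoid from \<open>y0\<close> in direction \<open>v\<close> is feasible; the stated
  inequality compares its norm with that of \<open>y0\<close>, multiplied by \<open>- (v \<bullet> (A *v v)) / t > 0\<close>, where \<open>t\<close> is
  the parameter of the far end.\<close>

lemma maximizer_chord:
  fixes A :: "real^'n^'n"
  assumes sym: "symmetric_matrix A"
    and neg: "\<And>x. x \<noteq> 0 \<Longrightarrow> x \<bullet> (A *v x) < 0"
    and active: "d \<bullet> y0 + y0 \<bullet> (A *v y0) = 0"
    and max: "\<And>y. d \<bullet> y + y \<bullet> (A *v y) \<ge> 0 \<Longrightarrow> y \<bullet> y \<le> y0 \<bullet> y0"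
    and pv: "(d + 2 *\<^sub>R (A *v y0)) \<bullet> v > 0"
  shows "2 * (y0 \<bullet> v) * (- (v \<bullet> (A *v v))) + ((d + 2 *\<^sub>R (A *v y0)) \<bullet> v) * (v \<bullet> v) \<le> 0"
proof -
  define b where "b = (d + 2 *\<^sub>R (A *v y0)) \<bullet> v"
  define a where "a = - (v \<bullet> (A *v v))"
  define t where "t = b / a"
  have "v \<noteq> 0" using pv by auto
  then have "a > 0" using neg by (simp add: a_def)
  moreover have "b > 0" using pv by (simp add: b_def)
  ultimately have "t > 0" and ta: "t * a = b" by (simp_all add: t_def)
  have "d \<bullet> (y0 + t *\<^sub>R v) + (y0 + t *\<^sub>R v) \<bullet> (A *v (y0 + t *\<^sub>R v)) = t * b - t\<^sup>2 * a"
    unfolding symmetric_quadratic_expand[OF sym] using active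
    by (simp add: a_def b_def inner_add_left inner_add_right inner_commute algebra_simps)
  also have "\<dots> = 0" unfolding ta[symmetric] by (simp add: power2_eq_square)
  finally have "(y0 + t *\<^sub>R v) \<bullet> (y0 + t *\<^sub>R v) \<le> y0 \<bullet> y0" using max by simp
  then have "t * (2 * (y0 \<bullet> v) + t * (v \<bullet> v)) \<le> 0"
    by (simp add: inner_add_left inner_add_right inner_commute algebra_simps)
  then have "2 * (y0 \<bullet> v) + t * (v \<bullet> v) \<le> 0" using \<open>t > 0\<close> by (simp add: mult_le_0_iff)
  then have "a * (2 * (y0 \<bullet> v) + t * (v \<bullet> v)) \<le> 0" using \<open>a > 0\<close> by (simp add: mult_le_0_iff)
  then show ?thesis
    unfolding a_def[symmetric] b_def[symmetric] ta[symmetric] by (simp add: algebra_simps)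
qed

text \<open>The S-lemma for this pair of forms, with the optimal multiplier. The vector \<open>d\<close> has to be
  nonzero for \<open>y0\<close> to be a regular point of the constraint; for \<open>d = 0\<close> coercivity supplies \<open>lam\<close>.\<close>

lemma maximizer_multiplier:
  fixes A :: "real^'n^'n"
  assumes sym: "symmetric_matrix A"
    and neg: "\<And>x. x \<noteq> 0 \<Longrightarrow> x \<bullet> (A *v x) < 0"
    and feas: "d \<bullet> y0 + y0 \<bullet> (A *v y0) \<ge> 0"
    and max: "\<And>y. d \<bullet> y + y \<bullet> (A *v y) \<ge> 0 \<Longrightarrow> y \<bullet> y \<le> y0 \<bullet> y0"
  obtains lam where "lam \<ge> 0"
    "\<And>y t. y \<bullet> y + lam * (t * (d \<bullet> y) + y \<bullet> (A *v y)) - (y0 \<bullet> y0) * t\<^sup>2 \<le> 0"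
proof (cases "d = 0")
  case True
  obtain \<mu> where \<mu>: "\<mu> > 0" "\<And>x. x \<bullet> (A *v x) \<le> - \<mu> * (x \<bullet> x)"
    using negative_definite_coercive neg by blast
  show ?thesis
  proof (rule that[of "1 / \<mu>"])
    fix y :: "real^'n" and t :: real
    have "y \<bullet> y + 1 / \<mu> * (y \<bullet> (A *v y)) \<le> 0"
      using \<mu>(1) \<mu>(2)[of y] by (simp add: field_simps)
    moreover have "(y0 \<bullet> y0) * t\<^sup>2 \<ge> 0" by simp
    ultimately show "y \<bullet> y + 1 / \<mu> * (t * (d \<bullet> y) + y \<bullet> (A *v y)) - (y0 \<bullet> y0) * t\<^sup>2 \<le> 0"
      unfolding True inner_zero_left mult_zero_right add_0_left by linarith
  qed (use \<mu>(1) in simp)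
next
  case False
  define p where "p = d + 2 *\<^sub>R (A *v y0)"
  have active: "d \<bullet> y0 + y0 \<bullet> (A *v y0) = 0"
    using maximizer_active feas max by blast
  note chord = maximizer_chord[OF sym neg active max, folded p_def]
  have "p \<noteq> 0"
  proof
    assume "p = 0"
    then have "p \<bullet> y0 = 0" by simp
    then have "y0 \<bullet> (A *v y0) = 0"
      using active by (simp add: p_def inner_add_left inner_commute[of _ y0] inner_add_right)
    then have "y0 = 0" using neg[of y0] by fastforce
    then show False using \<open>p = 0\<close> False by (simp add: p_def)
  qed
  have "y0 \<bullet> v < 0" if pv: "p \<bullet> v > 0" for v
  proof -
    have "v \<noteq> 0" using pv by auto
    then have "(p \<bullet> v) * (v \<bullet> v) > 0" using pv by simp
    then have "(y0 \<bullet> v) * (- (v \<bullet> (A *v v))) < 0" using chord[OF _ _ pv] by simp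
    then show ?thesis using neg[OF \<open>v \<noteq> 0\<close>] by (simp add: mult_less_0_iff zero_less_mult_iff)
  qed
  then obtain a where a: "a < 0" "y0 = a *\<^sub>R p"
    using opposite_of_halfspace[OF \<open>p \<noteq> 0\<close>] by blast
  define lam where "lam = - 2 * a"
  have lp: "lam * (p \<bullet> v) = - 2 * (y0 \<bullet> v)" for v by (simp add: a(2) lam_def)
  let ?M = "mat 1 + lam *\<^sub>R A"
  have M: "x \<bullet> (?M *v y) = x \<bullet> y + lam * (x \<bullet> (A *v y))" for x y
    by (simp add: matrix_vector_mult_add_rdistrib inner_add_right scaleR_matrix_vector_assoc[symmetric])
  have M_pos: "v \<bullet> (?M *v v) \<le> 0" if pv: "p \<bullet> v > 0" for v
  proof -
    have "(p \<bullet> v) * (v \<bullet> (?M *v v)) = 2 * (y0 \<bullet> v) * (- (v \<bullet> (A *v v))) + (p \<bullet> v) * (v \<bullet> v)"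
      using lp[of v] unfolding M by algebra
    also have "\<dots> \<le> 0" using chord[OF _ _ pv] by simp
    finally show ?thesis using pv by (simp add: mult_le_0_iff)
  qed
  \<comment> \<open>The form does not see the sign of \<open>v\<close>, so one open half-space covers the other.\<close>
  have M_nonpos: "v \<bullet> (?M *v v) \<le> 0" for v
  proof (rule nonpos_quadratic_dense[OF \<open>p \<noteq> 0\<close>])
    fix v assume "p \<bullet> v \<noteq> 0"
    then consider "p \<bullet> v > 0" | "p \<bullet> (- v) > 0" by fastforce
    then show "v \<bullet> (?M *v v) \<le> 0"
      using M_pos[of v] M_pos[of "- v"] by cases (simp_all add: linear_neg[OF matrix_vector_mul_linear])
  qed
  show ?thesis
  proof (rule that[of lam])
    show "lam \<ge> 0" using a(1) by (simp add: lam_def)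
    fix y :: "real^'n" and t :: real
    let ?w = "y + (- t) *\<^sub>R y0"
    \<comment> \<open>The multiplier rule \<open>2 *\<^sub>R y0 + lam *\<^sub>R p = 0\<close> eliminates \<open>d\<close>, and at \<open>y0\<close> itself, where the constraint is active,
        it fixes the coefficient of \<open>t\<^sup>2\<close> in the completed square.\<close>
    have dy: "lam * (d \<bullet> z) = - 2 * (y0 \<bullet> z) - 2 * lam * (z \<bullet> (A *v y0))" for z
      using lp[of z] by (simp add: p_def inner_add_left inner_commute[of "A *v y0"] distrib_left)
    have y0: "y0 \<bullet> y0 + lam * (y0 \<bullet> (A *v y0)) = - (y0 \<bullet> y0)"
      using dy[of y0] active by algebra
    have "?w \<bullet> (?M *v ?w) = ?w \<bullet> ?w + lam * (?w \<bullet> (A *v ?w))" by (rule M)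
    also have "\<dots> = y \<bullet> y - 2 * t * (y0 \<bullet> y) + t\<^sup>2 * (y0 \<bullet> y0)
        + lam * (y \<bullet> (A *v y) - 2 * t * (y \<bullet> (A *v y0)) + t\<^sup>2 * (y0 \<bullet> (A *v y0)))"
      unfolding symmetric_quadratic_expand[OF sym]
      using symmetric_matrix_inner[OF sym, of y0 y]
      by (simp add: inner_diff_left inner_diff_right inner_commute[of y y0] power2_eq_square
          right_diff_distrib)
    also have "\<dots> = y \<bullet> y + lam * (t * (d \<bullet> y) + y \<bullet> (A *v y)) - (y0 \<bullet> y0) * t\<^sup>2"
      using dy[of y] y0 by algebra
    finally show "y \<bullet> y + lam * (t * (d \<bullet> y) + y \<bullet> (A *v y)) - (y0 \<bullet> y0) * t\<^sup>2 \<le> 0"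
      using M_nonpos[of ?w] by simp
  qed
qed

section \<open>The bordered matrix\<close>

lemma sum_UNIV_Plus_unit:
  "(\<Sum>i\<in>UNIV. f i) = (\<Sum>k\<in>UNIV. f (Inl k :: 'a::finite + unit)) + f (Inr ())"
proof -
  have "(UNIV :: ('a + unit) set) = insert (Inr ()) (range Inl)"
    by (simp add: UNIV_sum UNIV_unit)
  then have "sum f UNIV = sum f (insert (Inr ()) (range Inl))" by (rule arg_cong)
  also have "\<dots> = (\<Sum>k\<in>UNIV. f (Inl k)) + f (Inr ())"
    by (subst sum.insert) (auto simp: sum.reindex add.commute)
  finally show ?thesis .
qed

lemma bordered_matrix_quadratic:
  fixes A :: "real^'n^'n" and z :: "real^('n + unit)"
  defines "y \<equiv> (\<chi> k. z $ Inl k)" and "t \<equiv> z $ Inr ()"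
  shows "z \<bullet> (bordered_matrix A u v s *v z) = y \<bullet> (A *v y) + t * (u \<bullet> y) + t * (v \<bullet> y) + s * t\<^sup>2"
proof -
  let ?Bz = "bordered_matrix A u v s *v z"
  have upper: "?Bz $ Inl k = (A *v y) $ k + t * u $ k" for k
    by (simp add: matrix_vector_mult_def bordered_matrix_def sum_UNIV_Plus_unit y_def t_def)
  have lower: "?Bz $ Inr () = v \<bullet> y + s * t"
    by (simp add: matrix_vector_mult_def bordered_matrix_def sum_UNIV_Plus_unit y_def t_def inner_vec_def)
  have "z \<bullet> ?Bz = (\<Sum>k\<in>UNIV. y $ k * ?Bz $ Inl k) + t * ?Bz $ Inr ()"
    by (simp add: inner_vec_def sum_UNIV_Plus_unit y_def t_def)
  also have "\<dots> = y \<bullet> (A *v y + t *\<^sub>R u) + t * (v \<bullet> y + s * t)"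
    unfolding upper lower by (simp add: inner_vec_def)
  also have "\<dots> = y \<bullet> (A *v y) + t * (u \<bullet> y) + t * (v \<bullet> y) + s * t\<^sup>2"
    by (simp add: inner_add_right inner_commute power2_eq_square algebra_simps)
  finally show ?thesis .
qed

lemma symmetric_bordered_matrix:
  assumes "symmetric_matrix A"
  shows "symmetric_matrix (bordered_matrix A u u s)"
proof -
  have "A $ l $ k = A $ k $ l" for k l
    using assms by (simp add: symmetric_matrix_def transpose_def vec_eq_iff)
  then show ?thesis
    by (simp add: symmetric_matrix_def transpose_def bordered_matrix_def vec_eq_iff split: sum.split)
qed

lemma sdp_feasible_iff:
  fixes m :: "real^'n"
  assumes "symmetric_matrix (A_s L Q m)"
  shows "(lam, \<gamma>) \<in> sdp_feasible c L Q m \<longleftrightarrow> lam \<ge> 0 \<and>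
    (\<forall>y t. y \<bullet> y + lam * (t * (d_vec c L Q m \<bullet> y) + y \<bullet> (A_s L Q m *v y)) - \<gamma> * t\<^sup>2 \<le> 0)"
    (is "_ \<longleftrightarrow> _ \<and> (\<forall>y t. ?q y t \<le> 0)")
proof -
  let ?d = "d_vec c L Q m" and ?M = "mat 1 + lam *\<^sub>R A_s L Q m"
  let ?B = "bordered_matrix ?M ((lam / 2) *\<^sub>R ?d) ((lam / 2) *\<^sub>R ?d) (- \<gamma>)"
  have form: "z \<bullet> (?B *v z) = ?q (\<chi> k. z $ Inl k) (z $ Inr ())" for z
    by (simp add: bordered_matrix_quadratic matrix_vector_mult_add_rdistrib inner_add_right
        scaleR_matrix_vector_assoc[symmetric] algebra_simps)
  have "symmetric_matrix ?M"
    using assms by (simp add: symmetric_matrix_def transpose_def mat_def vec_eq_iff)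
  then have "symmetric_matrix ?B" by (rule symmetric_bordered_matrix)
  moreover have "symmetric_matrix (0 :: real^('n + unit)^('n + unit))"
    by (simp add: symmetric_matrix_def transpose_def vec_eq_iff)
  ultimately have "?B \<preceq>\<^sub>L 0 \<longleftrightarrow> (\<forall>z. z \<bullet> (?B *v z) \<le> 0)"
    by (simp add: loewner_le_def zero_diff_matrix_vector del: diff_0)
  also have "\<dots> \<longleftrightarrow> (\<forall>y t. ?q y t \<le> 0)"
  proof (intro iffI allI)
    fix y :: "real^'n" and t :: real
    assume "\<forall>z. z \<bullet> (?B *v z) \<le> 0"
    then have "(\<chi> i. case i of Inl k \<Rightarrow> y $ k | Inr _ \<Rightarrow> t) \<bullet>
      (?B *v (\<chi> i. case i of Inl k \<Rightarrow> y $ k | Inr _ \<Rightarrow> t)) \<le> 0" by blast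
    then show "?q y t \<le> 0" unfolding form by simp
  qed (simp only: form)
  finally show ?thesis by (simp add: sdp_feasible_def)
qed

section \<open>Strong duality\<close>

theorem mainTheorem2:
  fixes c m :: "real^'n"
    and L :: "real^'n^'n"
    and Q :: "'n \<Rightarrow> real^'n^'n"
  assumes Q_sym: "\<And>i. symmetric_matrix (Q i)"
    and f_orth: "\<And>x. x \<bullet> quad_map Q x = 0"
    and As_neg: "A_s L Q m \<prec>\<^sub>L 0"
  shows "(\<exists>y\<in>qcqp_feasible c L Q m. ereal (y \<bullet> y) = qcqp_value c L Q m)
       \<and> (\<exists>(lam, \<gamma>)\<in>sdp_feasible c L Q m. ereal \<gamma> = sdp_value c L Q m)
       \<and> qcqp_value c L Q m = sdp_value c L Q m"
proof -
  let ?A = "A_s L Q m" and ?d = "d_vec c L Q m"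
  have sym: "symmetric_matrix ?A" and neg: "\<And>x. x \<noteq> 0 \<Longrightarrow> x \<bullet> (?A *v x) < 0"
    using As_neg by (auto simp: loewner_less_def zero_diff_matrix_vector simp del: diff_0)
  obtain y0 where y0: "?d \<bullet> y0 + y0 \<bullet> (?A *v y0) \<ge> 0"
    "\<And>y. ?d \<bullet> y + y \<bullet> (?A *v y) \<ge> 0 \<Longrightarrow> y \<bullet> y \<le> y0 \<bullet> y0"
    using quadratic_maximizer_exists neg by blast
  obtain lam where "lam \<ge> 0"
    "\<And>y t. y \<bullet> y + lam * (t * (?d \<bullet> y) + y \<bullet> (?A *v y)) - (y0 \<bullet> y0) * t\<^sup>2 \<le> 0"
    using maximizer_multiplier[OF sym neg y0] by blast
  then have dual: "(lam, y0 \<bullet> y0) \<in> sdp_feasible c L Q m"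
    by (simp add: sdp_feasible_iff[OF sym])
  have primal: "y0 \<in> qcqp_feasible c L Q m"
    using y0(1) by (simp add: qcqp_feasible_def)
  have weak: "y0 \<bullet> y0 \<le> \<gamma>" if "(l, \<gamma>) \<in> sdp_feasible c L Q m" for l \<gamma>
  proof -
    have "l \<ge> 0" and q: "y0 \<bullet> y0 + l * (1 * (?d \<bullet> y0) + y0 \<bullet> (?A *v y0)) - \<gamma> * 1\<^sup>2 \<le> 0"
      using that unfolding sdp_feasible_iff[OF sym] by blast+
    then have "l * (?d \<bullet> y0 + y0 \<bullet> (?A *v y0)) \<ge> 0" using y0(1) by simp
    then show ?thesis using q by simp
  qed
  have "qcqp_value c L Q m = ereal (y0 \<bullet> y0)"
    unfolding qcqp_value_def using primal y0(2)
    by (intro antisym SUP_least SUP_upper) (auto simp: qcqp_feasible_def)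
  moreover have "sdp_value c L Q m = ereal (y0 \<bullet> y0)"
    unfolding sdp_value_def using weak
    by (intro antisym INF_greatest INF_lower2[OF dual]) auto
  ultimately show ?thesis using primal dual by auto
qed

end
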